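(* Let $F=f+h$ be as in the context. Then the sequence of iterates $\{x_k\}_{k\ge0}$ generated by the algorithm ACUESA (described in the context), from any initial point $x_0\in\mathbb{R}^n$, exhibits the (optimal) linear rate of convergence: for all $k\ge0$, $$F(x_k)-\varphi_k^*\le\left(1-\sqrt{\tfrac{\mu}{L}}\right)^k\,(F(x_0)-\varphi_0^* ).$$
   Context: Setting: $F:=f+h$ on $\mathbb{R}^n$ (Euclidean norm), where $h:\mathbb{R}^n\to\mathbb{R}$ is convex (possibly nonsmooth) and $f:\mathbb{R}^n\to\mathbb{R}$ is continuously differentiable, $\mu$-strongly convex and $L$-smooth with $L\ge\mu>0$, i.e. for all $x,y\in\mathbb{R}^n$: $f(x)\ge f(y)+\langle\nabla f(y),x-y\rangle+\frac{\mu}{2}\|x-y\|^2$ and $f(x)\le f(y)+\langle\nabla f(y),x-y\rangle+\frac{L}{2}\|x-y\|^2$. Proximal gradient: $\mathrm{prox}_{h,L}(x):=\arg\min_u\{h(u)+\frac{L}{2}\|x-u\|^2\}$, $G_L(x):=L\left(x-\mathrm{prox}_{h,L}(x-\frac1L\nabla f(x))\right)$. For a point $x$: $x^+:=x-\frac1L G_L(x)$ and $x^{++}:=x-\frac1\mu G_L(x)$. Algorithm ACUESA (run without its stopping test $F(x_k)-\varphi_k^*\le\epsilon$, so that infinite sequences are produced): given $x_0$, set $\alpha_k=\sqrt{\mu/L}$ and $\beta_k=\frac{1}{1+\alpha_k}$ for all $k\ge0$, $v_0=x_0^{++}$ and $\varphi_0^*=F(x_0^+)+\left(\frac1{2L}-\frac1{2\mu}\right)\|G_L(x_0)\|^2$.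 For $k=0,1,2,\dots$: set $y_k=\beta_k x_k+(1-\beta_k)v_k$; $x_{k+1}=y_k-\frac1L G_L(y_k)$; $v_{k+1}=(1-\alpha_k)v_k+\alpha_k y_k^{++}$; and $$\varphi_{k+1}^*=(1-\alpha_k)\left(\varphi_k^*+\tfrac{\mu}{2}\|v_{k+1}-v_k\|^2\right)+\alpha_k\left(F(y_k^+)+\left(\tfrac1{2L}-\tfrac1{2\mu}\right)\|G_L(y_k)\|^2+\tfrac{\mu}{2}\|v_{k+1}-y_k^{++}\|^2\right).$$ *)

theory Defs
  imports "HOL-Analysis.Analysis"
begin

text \<open>Only meaningful where \<open>f\<close> is differentiable.\<close>

definition grad :: "('a::real_inner \<Rightarrow> real) \<Rightarrow> 'a \<Rightarrow> 'a" where
  "grad f x = (THE D. GDERIV f x :> D)"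

text \<open>
  \<open>arg_min\<close> picks some minimizer; for convex \<open>h\<close> on a Euclidean space and \<open>L > 0\<close> the
  minimizer exists and is unique.
\<close>

definition prox :: "('a::real_inner \<Rightarrow> real) \<Rightarrow> real \<Rightarrow> 'a \<Rightarrow> 'a" where
  "prox h L x = arg_min (\<lambda>u. h u + L / 2 * (norm (x - u))\<^sup>2) (\<lambda>_. True)"

definition grad_map :: "('a::real_inner \<Rightarrow> real) \<Rightarrow> ('a \<Rightarrow> real) \<Rightarrow> real \<Rightarrow> 'a \<Rightarrow> 'a" where
  "grad_map f h L x = L *\<^sub>R (x - prox h L (x - (1 / L) *\<^sub>R grad f x))"

text \<open>The points $x^+$ and $x^{++}$.\<close>

definition short_step :: "('a::real_inner \<Rightarrow> real) \<Rightarrow> ('a \<Rightarrow> real) \<Rightarrow> real \<Rightarrow> 'a \<Rightarrow> 'a" where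
  "short_step f h L x = x - (1 / L) *\<^sub>R grad_map f h L x"

definition long_step :: "('a::real_inner \<Rightarrow> real) \<Rightarrow> ('a \<Rightarrow> real) \<Rightarrow> real \<Rightarrow> real \<Rightarrow> 'a \<Rightarrow> 'a" where
  "long_step f h \<mu> L x = x - (1 / \<mu>) *\<^sub>R grad_map f h L x"

definition acuesa_alpha :: "real \<Rightarrow> real \<Rightarrow> nat \<Rightarrow> real" where
  "acuesa_alpha \<mu> L k = sqrt (\<mu> / L)"

definition acuesa_beta :: "real \<Rightarrow> real \<Rightarrow> nat \<Rightarrow> real" where
  "acuesa_beta \<mu> L k = 1 / (1 + acuesa_alpha \<mu> L k)"

text \<open>
  The state after \<open>k\<close> iterations is the triple $(x_k, v_k, \varphi_k^*)$; the stopping test is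
  omitted.
\<close>

definition acuesa_init ::
  "('a::real_inner \<Rightarrow> real) \<Rightarrow> ('a \<Rightarrow> real) \<Rightarrow> real \<Rightarrow> real \<Rightarrow> 'a \<Rightarrow> 'a \<times> 'a \<times> real" where
  "acuesa_init f h \<mu> L x0 =
     (x0,
      long_step f h \<mu> L x0,
      f (short_step f h L x0) + h (short_step f h L x0)
        + (1 / (2 * L) - 1 / (2 * \<mu>)) * (norm (grad_map f h L x0))\<^sup>2)"

definition acuesa_step ::
  "('a::real_inner \<Rightarrow> real) \<Rightarrow> ('a \<Rightarrow> real) \<Rightarrow> real \<Rightarrow> real \<Rightarrow> nat
     \<Rightarrow> 'a \<times> 'a \<times> real \<Rightarrow> 'a \<times> 'a \<times> real" where
  "acuesa_step f h \<mu> L k = (\<lambda>(x, v, \<phi>).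
     let \<alpha> = acuesa_alpha \<mu> L k;
         \<beta> = acuesa_beta \<mu> L k;
         y = \<beta> *\<^sub>R x + (1 - \<beta>) *\<^sub>R v;
         x' = y - (1 / L) *\<^sub>R grad_map f h L y;
         v' = (1 - \<alpha>) *\<^sub>R v + \<alpha> *\<^sub>R long_step f h \<mu> L y;
         \<phi>' = (1 - \<alpha>) * (\<phi> + \<mu> / 2 * (norm (v' - v))\<^sup>2)
               + \<alpha> * (f (short_step f h L y) + h (short_step f h L y)
                      + (1 / (2 * L) - 1 / (2 * \<mu>)) * (norm (grad_map f h L y))\<^sup>2
                      + \<mu> / 2 * (norm (v' - long_step f h \<mu> L y))\<^sup>2)
     in (x', v', \<phi>'))"

primrec acuesa ::
  "('a::real_inner \<Rightarrow> real) \<Rightarrow> ('a \<Rightarrow> real) \<Rightarrow> real \<Rightarrow> real \<Rightarrow> 'a \<Rightarrow> nat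
     \<Rightarrow> 'a \<times> 'a \<times> real" where
  "acuesa f h \<mu> L x0 0 = acuesa_init f h \<mu> L x0"
| "acuesa f h \<mu> L x0 (Suc k) = acuesa_step f h \<mu> L k (acuesa f h \<mu> L x0 k)"

definition acuesa_x ::
  "('a::real_inner \<Rightarrow> real) \<Rightarrow> ('a \<Rightarrow> real) \<Rightarrow> real \<Rightarrow> real \<Rightarrow> 'a \<Rightarrow> nat \<Rightarrow> 'a" where
  "acuesa_x f h \<mu> L x0 k = fst (acuesa f h \<mu> L x0 k)"

definition acuesa_phi ::
  "('a::real_inner \<Rightarrow> real) \<Rightarrow> ('a \<Rightarrow> real) \<Rightarrow> real \<Rightarrow> real \<Rightarrow> 'a \<Rightarrow> nat \<Rightarrow> real" where
  "acuesa_phi f h \<mu> L x0 k = snd (snd (acuesa f h \<mu> L x0 k))"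

end

theory Submission
  imports Defs
begin

text \<open>
  Each iteration contracts the gap between \<open>F (x\<^sub>k)\<close> and the estimate \<open>\<phi>\<^sub>k\<close> by the factor
  \<open>1 - \<alpha>\<close> with \<open>\<alpha> = sqrt (\<mu> / L)\<close>; the theorem is the iterate of this fact.

  The convexity of \<open>h\<close> enters through the proximal point. It exists, because a convex function
  decreases at most linearly and so cannot compensate the quadratic penalty, and it satisfies a
  variational inequality (\<open>prox_variational_inequality\<close>), which says that \<open>L (x - p)\<close> is a
  subgradient of \<open>h\<close> at the proximal point \<open>p\<close> of \<open>x\<close>. Adding this to the quadratic bounds on
  \<open>f\<close> gives, with \<open>g\<close> the gradient mapping at \<open>y\<close>, the lower bound
  \<open>F x \<ge> F y\<^sup>+ + g \<bullet> (x - y) + \<parallel>g\<parallel>\<^sup>2 / (2 L) + \<mu> / 2 \<parallel>x - y\<parallel>\<^sup>2\<close>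
  (\<open>composite_lower_bound\<close>).

  The points \<open>v\<^sub>k\<close> and \<open>\<phi>\<^sub>k\<close> are the minimizer and the minimum of a quadratic
  \<open>\<phi>\<^sub>k + \<mu> / 2 \<parallel>z - v\<^sub>k\<parallel>\<^sup>2\<close>. A step replaces it by its convex combination, with weights
  \<open>1 - \<alpha>\<close> and \<open>\<alpha>\<close>, with the lower bound above, itself a quadratic in \<open>x\<close> of the same curvature
  with minimizer \<open>y\<^sup>+\<^sup>+\<close>. In the new minimum the coefficient of \<open>\<parallel>g\<parallel>\<^sup>2\<close> collapses to
  \<open>- (1 - \<alpha>) / (2 L)\<close> because \<open>\<alpha>\<^sup>2 = \<mu> / L\<close>, and the choice of \<open>y\<^sub>k\<close> makes
  \<open>x\<^sub>k - y\<^sub>k = - \<alpha> (v\<^sub>k - y\<^sub>k)\<close>. With these two cancellations the contraction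
  (\<open>acuesa_gap_step\<close>) is the lower bound evaluated at \<open>x = x\<^sub>k\<close>.
\<close>

section \<open>The proximal point\<close>

text \<open>
  The minimum \<open>m\<close> of \<open>h\<close> over the unit ball around \<open>x\<close> controls the slope of \<open>h\<close> along every ray
  from \<open>x\<close>, so at distance \<open>r \<ge> 1\<close> we have \<open>h \<ge> h x - r (h x - m)\<close>. Hence the objective is
  at least its value at \<open>x\<close> outside a sufficiently large ball, and compactness applies inside.
\<close>

lemma prox_objective_attains_min:
  fixes h :: "'a::euclidean_space \<Rightarrow> real"
  assumes conv: "convex_on UNIV h" and L: "0 < L"
  shows "\<exists>p. \<forall>u. h p + L / 2 * (norm (x - p))\<^sup>2 \<le> h u + L / 2 * (norm (x - u))\<^sup>2"
proof -
  define q where "q u = h u + L / 2 * (norm (x - u))\<^sup>2" for u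
  have cont: "continuous_on UNIV h"
    using convex_on_continuous[OF open_UNIV conv] .
  have "continuous_on (cball x 1) h"
    using cont continuous_on_subset by blast
  then have "\<exists>m\<in>cball x 1. \<forall>w\<in>cball x 1. h m \<le> h w"
    by (intro continuous_attains_inf) auto
  then obtain m where m: "\<And>w. w \<in> cball x 1 \<Longrightarrow> h m \<le> h w"
    by blast
  define c where "c = h x - h m"
  define R where "R = max 1 (2 * c / L)"
  have "continuous_on (cball x R) q"
    unfolding q_def
    by (intro continuous_intros continuous_on_subset[OF cont]) auto
  moreover have "cball x R \<noteq> {}"
    by (simp add: R_def)
  ultimately have "\<exists>p\<in>cball x R. \<forall>w\<in>cball x R. q p \<le> q w"
    by (intro continuous_attains_inf) auto
  then obtain p where p: "\<And>w. w \<in> cball x R \<Longrightarrow> q p \<le> q w"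
    by blast
  have "q p \<le> q u" for u
  proof (cases "u \<in> cball x R")
    case True
    then show ?thesis by (rule p)
  next
    case False
    define r where "r = norm (x - u)"
    define w where "w = x + (1 / r) *\<^sub>R (u - x)"
    from False have r: "1 < r" "2 * c / L < r"
      by (auto simp: R_def r_def dist_norm)
    have "norm (w - x) = 1"
      using r by (auto simp: w_def r_def norm_minus_commute)
    then have "h m \<le> h w"
      by (intro m) (simp add: dist_norm norm_minus_commute)
    also have "w = (1 - 1 / r) *\<^sub>R x + (1 / r) *\<^sub>R u"
      by (simp add: w_def algebra_simps)
    also have "h \<dots> \<le> (1 - 1 / r) * h x + (1 / r) * h u"
      using r by (intro convex_onD[OF conv]) auto
    finally have "r * h m \<le> r * ((1 - 1 / r) * h x + (1 / r) * h u)"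
      using r by (intro mult_left_mono) auto
    also have "\<dots> = (r - 1) * h x + h u"
      using r by (simp add: field_simps)
    finally have "h x - r * c \<le> h u"
      by (simp add: c_def algebra_simps)
    moreover have "r * c \<le> L / 2 * r\<^sup>2"
    proof -
      have "c \<le> L / 2 * r"
        using r L by (simp add: field_simps)
      then have "r * c \<le> r * (L / 2 * r)"
        using r by (intro mult_left_mono) auto
      then show ?thesis
        by (simp add: power2_eq_square algebra_simps)
    qed
    ultimately have "q x \<le> q u"
      by (simp add: q_def r_def)
    moreover have "q p \<le> q x"
      by (rule p) (simp add: R_def)
    ultimately show ?thesis by simp
  qed
  then show ?thesis
    unfolding q_def by blast
qed

lemma prox_minimal:
  fixes h :: "'a::euclidean_space \<Rightarrow> real"
  assumes "convex_on UNIV h" and "0 < L"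
  shows "h (prox h L x) + L / 2 * (norm (x - prox h L x))\<^sup>2
           \<le> h u + L / 2 * (norm (x - u))\<^sup>2"
proof -
  have "\<exists>p. is_arg_min (\<lambda>u. h u + L / 2 * (norm (x - u))\<^sup>2) (\<lambda>_. True) p"
    using prox_objective_attains_min[OF assms, of x] by (simp add: is_arg_min_linorder)
  then have "is_arg_min (\<lambda>u. h u + L / 2 * (norm (x - u))\<^sup>2) (\<lambda>_. True) (prox h L x)"
    unfolding prox_def arg_min_def by (rule someI_ex)
  then show ?thesis
    by (simp add: is_arg_min_linorder)
qed

text \<open>
  Minimality is tested against the points \<open>p + t (u - p)\<close> of the segment from the proximal point
  to \<open>u\<close>. After division by \<open>t\<close> the only error is the quadratic term \<open>t L / 2 \<parallel>u - p\<parallel>\<^sup>2\<close>,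
  which vanishes as \<open>t\<close> tends to \<open>0\<close>.
\<close>

lemma prox_variational_inequality:
  fixes h :: "'a::euclidean_space \<Rightarrow> real" and x u :: 'a
  assumes conv: "convex_on UNIV h" and L: "0 < L"
  defines "p \<equiv> prox h L x"
  shows "h p + L * ((x - p) \<bullet> (u - p)) \<le> h u"
proof -
  define s where "s = h u - h p - L * ((x - p) \<bullet> (u - p))"
  define K where "K = L / 2 * (norm (u - p))\<^sup>2"
  have bound: "0 \<le> s + t * K" if t: "0 < t" "t < 1" for t
  proof -
    let ?w = "(1 - t) *\<^sub>R p + t *\<^sub>R u"
    have "h p + L / 2 * (norm (x - p))\<^sup>2 \<le> h ?w + L / 2 * (norm (x - ?w))\<^sup>2"
      unfolding p_def by (rule prox_minimal[OF conv L])
    moreover have "h ?w \<le> (1 - t) * h p + t * h u"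
      using t by (intro convex_onD[OF conv]) auto
    moreover have "(norm (x - ?w))\<^sup>2
        = (norm (x - p))\<^sup>2 - 2 * t * ((x - p) \<bullet> (u - p)) + t\<^sup>2 * (norm (u - p))\<^sup>2"
    proof -
      have "x - ?w = (x - p) - t *\<^sub>R (u - p)"
        by (simp add: algebra_simps)
      then show ?thesis
        by (simp only: power2_norm_eq_inner)
           (simp add: inner_diff_left inner_diff_right inner_commute power2_eq_square algebra_simps)
    qed
    ultimately have "h p + L / 2 * (norm (x - p))\<^sup>2 \<le> (1 - t) * h p + t * h u
        + L / 2 * ((norm (x - p))\<^sup>2 - 2 * t * ((x - p) \<bullet> (u - p)) + t\<^sup>2 * (norm (u - p))\<^sup>2)"
      by simp
    also have "\<dots> = h p + L / 2 * (norm (x - p))\<^sup>2 + t * (s + t * K)"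
      by (simp add: s_def K_def power2_eq_square field_simps)
    finally have "0 \<le> t * (s + t * K)"
      by simp
    then show ?thesis
      using t by (simp add: zero_le_mult_iff)
  qed
  have "((\<lambda>t. s + t * K) \<longlongrightarrow> s + 0 * K) (at_right 0)"
    by (intro tendsto_intros)
  moreover have "eventually (\<lambda>t. 0 \<le> s + t * K) (at_right 0)"
    unfolding eventually_at_right_field using bound by (intro exI[of _ 1]) auto
  ultimately have "0 \<le> s + 0 * K"
    by (intro tendsto_lowerbound) auto
  then show ?thesis
    by (simp add: s_def)
qed

section \<open>The lower bound at a proximal gradient step\<close>

text \<open>
  Optimality of the step makes \<open>g - \<nabla>f y\<close> a subgradient of \<open>h\<close> at \<open>y\<^sup>+\<close>, where \<open>g\<close> is the
  gradient mapping. Summed with strong convexity from \<open>y\<close> to \<open>x\<close> and smoothness from \<open>y\<close> to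
  \<open>y\<^sup>+\<close>, the terms in \<open>\<nabla>f y\<close> cancel, and \<open>y\<^sup>+ - y = - g / L\<close> turns the rest into a quadratic
  in \<open>x - y\<close>.
\<close>

lemma composite_lower_bound:
  fixes f h :: "'a::euclidean_space \<Rightarrow> real"
  assumes conv: "convex_on UNIV h" and L: "0 < L"
    and sc: "f x \<ge> f y + grad f y \<bullet> (x - y) + \<mu> / 2 * (norm (x - y))\<^sup>2"
    and smooth: "\<And>z. f z \<le> f y + grad f y \<bullet> (z - y) + L / 2 * (norm (z - y))\<^sup>2"
  defines "g \<equiv> grad_map f h L y" and "p \<equiv> short_step f h L y"
  shows "f p + h p + g \<bullet> (x - y) + 1 / (2 * L) * (norm g)\<^sup>2 + \<mu> / 2 * (norm (x - y))\<^sup>2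
           \<le> f x + h x"
proof -
  define d where "d = grad f y"
  have p_prox: "p = prox h L (y - (1 / L) *\<^sub>R d)"
    using L by (simp add: p_def short_step_def grad_map_def d_def)
  have py: "p = y - (1 / L) *\<^sub>R g"
    by (simp add: p_def g_def short_step_def)
  have "h p + L * ((y - (1 / L) *\<^sub>R d - p) \<bullet> (x - p)) \<le> h x"
    unfolding p_prox by (rule prox_variational_inequality[OF conv L])
  moreover have "L * ((y - (1 / L) *\<^sub>R d - p) \<bullet> (x - p)) = (g - d) \<bullet> (x - p)"
  proof -
    have "y - (1 / L) *\<^sub>R d - p = (1 / L) *\<^sub>R (g - d)"
      by (simp add: py algebra_simps)
    then show ?thesis
      using L by simp
  qed
  moreover have "(g - d) \<bullet> (x - p) = g \<bullet> (x - y) + 1 / L * (norm g)\<^sup>2 - d \<bullet> (x - y) + d \<bullet> (p - y)"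
    unfolding py power2_norm_eq_inner
    by (simp add: inner_diff_left inner_diff_right inner_add_right algebra_simps)
  moreover have "f p \<le> f y + d \<bullet> (p - y) + 1 / (2 * L) * (norm g)\<^sup>2"
  proof -
    have "L / 2 * (norm (p - y))\<^sup>2 = 1 / (2 * L) * (norm g)\<^sup>2"
      using L by (simp add: py power_mult_distrib power2_eq_square field_simps)
    then show ?thesis
      using smooth[of p] by (simp add: d_def)
  qed
  moreover have "1 / L * (norm g)\<^sup>2 = 2 * (1 / (2 * L) * (norm g)\<^sup>2)"
    by simp
  ultimately show ?thesis
    using sc unfolding d_def by linarith
qed

section \<open>Contraction of the gap\<close>

text \<open>
  This evaluates the minimum of the combined quadratic, where \<open>y - g / \<mu>\<close> plays the role of
  \<open>y\<^sup>+\<^sup>+\<close>. It lies at the convex combination of the two minimizers and exceeds the combination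
  of the two minima by \<open>\<alpha> (1 - \<alpha>) \<mu> / 2\<close> times their squared distance.
\<close>

lemma combined_quadratic_min:
  fixes v y g :: "'a::real_inner" and \<mu> \<alpha> :: real
  assumes mu: "\<mu> \<noteq> 0"
  defines "w \<equiv> y - (1 / \<mu>) *\<^sub>R g"
  defines "v' \<equiv> (1 - \<alpha>) *\<^sub>R v + \<alpha> *\<^sub>R w"
  shows "(1 - \<alpha>) * (\<mu> / 2 * (norm (v' - v))\<^sup>2) + \<alpha> * (\<mu> / 2 * (norm (v' - w))\<^sup>2)
    = \<alpha> * (1 - \<alpha>) * (\<mu> / 2 * (norm (v - y))\<^sup>2 + g \<bullet> (v - y) + 1 / (2 * \<mu>) * (norm g)\<^sup>2)"
proof -
  have "v' - v = \<alpha> *\<^sub>R (w - v)" "v' - w = (1 - \<alpha>) *\<^sub>R (v - w)"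
    by (simp_all add: v'_def algebra_simps)
  then have sq: "(norm (v' - v))\<^sup>2 = \<alpha>\<^sup>2 * (norm (v - w))\<^sup>2"
      "(norm (v' - w))\<^sup>2 = (1 - \<alpha>)\<^sup>2 * (norm (v - w))\<^sup>2"
    by (simp_all add: power_mult_distrib norm_minus_commute)
  have "(1 - a) * (m * (a\<^sup>2 * D)) + a * (m * ((1 - a)\<^sup>2 * D)) = a * (1 - a) * (m * D)"
    for a m D :: real
    by algebra
  then have "(1 - \<alpha>) * (\<mu> / 2 * (norm (v' - v))\<^sup>2) + \<alpha> * (\<mu> / 2 * (norm (v' - w))\<^sup>2)
      = \<alpha> * (1 - \<alpha>) * (\<mu> / 2 * (norm (v - w))\<^sup>2)"
    unfolding sq .
  moreover have "\<mu> / 2 * (norm (v - w))\<^sup>2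
      = \<mu> / 2 * (norm (v - y))\<^sup>2 + g \<bullet> (v - y) + 1 / (2 * \<mu>) * (norm g)\<^sup>2"
  proof -
    have "v - w = (v - y) + (1 / \<mu>) *\<^sub>R g"
      by (simp add: w_def)
    then have "(norm (v - w))\<^sup>2
        = (norm (v - y))\<^sup>2 + 2 / \<mu> * (g \<bullet> (v - y)) + (1 / \<mu>)\<^sup>2 * (norm g)\<^sup>2"
      by (simp only: power2_norm_eq_inner)
         (simp add: inner_add_left inner_add_right inner_commute power2_eq_square)
    then show ?thesis
      using mu by (simp add: power2_eq_square field_simps)
  qed
  ultimately show ?thesis by (simp only:)
qed

lemma acuesa_gap_step:
  fixes f h :: "'a::euclidean_space \<Rightarrow> real"
  assumes conv: "convex_on UNIV h" and mu: "0 < \<mu>" and muL: "\<mu> \<le> L"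
    and sc: "\<And>x y. f x \<ge> f y + grad f y \<bullet> (x - y) + \<mu> / 2 * (norm (x - y))\<^sup>2"
    and smooth: "\<And>x y. f x \<le> f y + grad f y \<bullet> (x - y) + L / 2 * (norm (x - y))\<^sup>2"
    and step: "acuesa_step f h \<mu> L k (x, v, \<phi>) = (x', v', \<phi>')"
  shows "f x' + h x' - \<phi>' \<le> (1 - sqrt (\<mu> / L)) * (f x + h x - \<phi>)"
proof -
  define \<alpha> where "\<alpha> = sqrt (\<mu> / L)"
  define \<beta> where "\<beta> = 1 / (1 + \<alpha>)"
  define y where "y = \<beta> *\<^sub>R x + (1 - \<beta>) *\<^sub>R v"
  define g where "g = grad_map f h L y"
  define N where "N = (norm g)\<^sup>2"
  have L: "0 < L" using mu muL by simp
  have \<alpha>: "0 < \<alpha>" "\<alpha> \<le> 1" "\<alpha>\<^sup>2 = \<mu> / L"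
    using mu muL L by (auto simp: \<alpha>_def)
  have x': "x' = short_step f h L y"
    and v': "v' = (1 - \<alpha>) *\<^sub>R v + \<alpha> *\<^sub>R (y - (1 / \<mu>) *\<^sub>R g)"
    and \<phi>': "\<phi>' = (1 - \<alpha>) * (\<phi> + \<mu> / 2 * (norm (v' - v))\<^sup>2)
       + \<alpha> * (f x' + h x' + (1 / (2 * L) - 1 / (2 * \<mu>)) * N
              + \<mu> / 2 * (norm (v' - (y - (1 / \<mu>) *\<^sub>R g)))\<^sup>2)"
    using step
    by (auto simp: acuesa_step_def Let_def acuesa_alpha_def acuesa_beta_def short_step_def
        long_step_def \<alpha>_def \<beta>_def y_def g_def N_def)
  have phi: "\<phi>' = (1 - \<alpha>) * \<phi> + \<alpha> * (f x' + h x' + (1 / (2 * L) - 1 / (2 * \<mu>)) * N)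
      + \<alpha> * (1 - \<alpha>) * (\<mu> / 2 * (norm (v - y))\<^sup>2 + g \<bullet> (v - y) + 1 / (2 * \<mu>) * N)"
    unfolding \<phi>' N_def
    using combined_quadratic_min[of \<mu> \<alpha> v y g] mu by (simp add: v' algebra_simps)
  \<comment> \<open>Since \<open>\<alpha>\<^sup>2 / (2 \<mu>) = 1 / (2 L)\<close>, the coefficient of \<open>N\<close> in \<open>\<phi>'\<close> carries the factor
    \<open>1 - \<alpha>\<close> of the contraction.\<close>
  have coeff: "\<alpha> * (1 / (2 * L) - 1 / (2 * \<mu>)) + \<alpha> * (1 - \<alpha>) * (1 / (2 * \<mu>))
      = - (1 - \<alpha>) * (1 / (2 * L))"
  proof -
    have "a * (l - m) + a * (1 - a) * m = a * l - a\<^sup>2 * m" for a l m :: real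
      by algebra
    then have "\<alpha> * (1 / (2 * L) - 1 / (2 * \<mu>)) + \<alpha> * (1 - \<alpha>) * (1 / (2 * \<mu>))
        = \<alpha> * (1 / (2 * L)) - \<alpha>\<^sup>2 * (1 / (2 * \<mu>))" .
    also have "\<alpha>\<^sup>2 * (1 / (2 * \<mu>)) = 1 / (2 * L)"
      using mu L by (simp add: \<alpha>(3))
    finally show ?thesis
      by (simp only: minus_diff_eq left_diff_distrib mult_1_left)
  qed
  have "\<phi>' = (1 - \<alpha>) * \<phi> + \<alpha> * (f x' + h x')
      + (\<alpha> * (1 / (2 * L) - 1 / (2 * \<mu>)) + \<alpha> * (1 - \<alpha>) * (1 / (2 * \<mu>))) * N
      + \<alpha> * (1 - \<alpha>) * (\<mu> / 2 * (norm (v - y))\<^sup>2 + g \<bullet> (v - y))"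
    unfolding phi by (simp add: algebra_simps)
  note phi_coeff = this[unfolded coeff]
  have "A - ((1 - a) * p + a * A + - (1 - a) * l * n + a * (1 - a) * (Q + i))
      = (1 - a) * (A - a * i + l * n - a * Q - p)" for A a p l n Q i :: real
    by algebra
  then have phi_gap: "f x' + h x' - \<phi>' = (1 - \<alpha>) *
      (f x' + h x' - \<alpha> * (g \<bullet> (v - y)) + 1 / (2 * L) * N
       - \<alpha> * (\<mu> / 2 * (norm (v - y))\<^sup>2) - \<phi>)"
    unfolding phi_coeff .
  have "x - y = - (\<alpha> *\<^sub>R (v - y))"
  proof -
    have "(1 + \<alpha>) *\<^sub>R y = ((1 + \<alpha>) * \<beta>) *\<^sub>R x + ((1 + \<alpha>) * (1 - \<beta>)) *\<^sub>R v"
      by (simp add: y_def scaleR_add_right)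
    also have "(1 + \<alpha>) * \<beta> = 1"
      using \<alpha>(1) by (simp add: \<beta>_def)
    also have "(1 + \<alpha>) * (1 - \<beta>) = \<alpha>"
      using \<alpha>(1) by (simp add: \<beta>_def field_simps)
    finally show ?thesis by (simp add: algebra_simps)
  qed
  then have "g \<bullet> (x - y) = - \<alpha> * (g \<bullet> (v - y))"
    by simp
  moreover have "f x' + h x' + g \<bullet> (x - y) + 1 / (2 * L) * N + \<mu> / 2 * (norm (x - y))\<^sup>2
      \<le> f x + h x"
    unfolding x' g_def N_def by (rule composite_lower_bound[OF conv L sc smooth])
  moreover have "0 \<le> \<mu> / 2 * (norm (x - y))\<^sup>2" "0 \<le> \<alpha> * (\<mu> / 2 * (norm (v - y))\<^sup>2)"
    using mu \<alpha>(1) by simp_all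
  ultimately have "f x' + h x' - \<alpha> * (g \<bullet> (v - y)) + 1 / (2 * L) * N
      - \<alpha> * (\<mu> / 2 * (norm (v - y))\<^sup>2) - \<phi> \<le> f x + h x - \<phi>"
    by linarith
  then show ?thesis
    unfolding phi_gap \<alpha>_def[symmetric] using \<alpha>(2) by (intro mult_left_mono) auto
qed

theorem corollary2:
  fixes f h F :: "real ^ 'n \<Rightarrow> real" and \<mu> L :: real and x0 :: "real ^ 'n"
  assumes F: "\<And>x. F x = f x + h x"
    and h_convex: "convex_on UNIV h"
    and f_diff: "\<And>x. f differentiable (at x)"
    and f_C1: "continuous_on UNIV (grad f)"
    and mu_pos: "0 < \<mu>" and mu_le_L: "\<mu> \<le> L"
    and f_strongly_convex:
      "\<And>x y. f x \<ge> f y + grad f y \<bullet> (x - y) + \<mu> / 2 * (norm (x - y))\<^sup>2"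
    and f_smooth:
      "\<And>x y. f x \<le> f y + grad f y \<bullet> (x - y) + L / 2 * (norm (x - y))\<^sup>2"
  shows "\<forall>k. F (acuesa_x f h \<mu> L x0 k) - acuesa_phi f h \<mu> L x0 k
           \<le> (1 - sqrt (\<mu> / L)) ^ k * (F x0 - acuesa_phi f h \<mu> L x0 0)"
proof
  fix k
  let ?gap = "\<lambda>k. F (acuesa_x f h \<mu> L x0 k) - acuesa_phi f h \<mu> L x0 k"
  let ?\<rho> = "1 - sqrt (\<mu> / L)"
  have contraction: "?gap (Suc k) \<le> ?\<rho> * ?gap k" for k
  proof -
    obtain x v \<phi> where st: "acuesa f h \<mu> L x0 k = (x, v, \<phi>)"
      by (rule prod_cases3)
    obtain x' v' \<phi>' where st': "acuesa_step f h \<mu> L k (x, v, \<phi>) = (x', v', \<phi>')"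
      by (rule prod_cases3)
    show ?thesis
      using acuesa_gap_step[OF h_convex mu_pos mu_le_L f_strongly_convex f_smooth st']
      by (simp add: acuesa_x_def acuesa_phi_def st st' F)
  qed
  have "0 \<le> ?\<rho>"
    using mu_pos mu_le_L by simp
  show "?gap k \<le> ?\<rho> ^ k * (F x0 - acuesa_phi f h \<mu> L x0 0)"
  proof (induction k)
    case 0
    show ?case by (simp add: acuesa_x_def acuesa_init_def)
  next
    case (Suc k)
    have "?gap (Suc k) \<le> ?\<rho> * ?gap k"
      by (rule contraction)
    also have "\<dots> \<le> ?\<rho> * (?\<rho> ^ k * (F x0 - acuesa_phi f h \<mu> L x0 0))"
      using Suc.IH \<open>0 \<le> ?\<rho>\<close> by (rule mult_left_mono)
    finally show ?case by (simp add: mult.assoc)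
  qed
qed

end
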